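(* Let $\mathcal{D}=\{x_n\}_{n=1}^N\subset\mathbb{R}^d$ be a finite dataset (each point already written in the representation space, i.e. $x_n$ stands for $\phi(x_n)$) with $\|x_n\|_2\le 1$ for all $n$. Let $\sigma:\mathbb{R}\to[-1,1]$ be an odd activation function (such as $\tanh$), let $\theta\in\mathbb{R}^d$, $\theta\neq 0$, and let $\tau_\theta(x)=\sigma(\theta^T x)$. Assume that $\mathcal{D}$ with labeling $\tau_\theta$ is linearly separable and non-degenerate (as defined in the context). Let $w_0\in\mathbb{R}^d$ be any starting point, let the step size satisfy $0<\eta<1/\mathcal{L}_\theta(w_0)$, where $\mathcal{L}_\theta(w)=\sum_{n=1}^N\exp(-\tau_\theta(x_n)w^Tx_n)$, and let $w_M$ be the $M$-th gradient descent iterate, $w_m=w_{m-1}-\eta\nabla_w\mathcal{L}_\theta(w_{m-1})$ for $m=1,\dots,M$. Define $$\mathcal{L}^{\text{binary}}_M(\theta)=\sum_{n=1}^N\exp\left(-\tau_\theta(x_n)\,w_M^Tx_n\right).$$ Then, for almost every such dataset, the residual $r_M(\theta)$ (defined in the context) is bounded in $M$ with $\lim_{M\to\infty}\|r_M(\theta)\|_2=0$, and for all sufficiently large $M$, $$\mathcal{L}^{\text{binary}}_M(\theta)\ \ge\ g(\theta)\,\|w_{\text{SVM}}(\theta)\|_2^2,\qquad g(\theta)=\left(M\,\eta\,\exp(\|r_M(\theta)\|_2)\right)^{-1},$$ where $w_{\text{SVM}}(\theta)$ is the solution of the hard-margin SVM problem $$w_{\text{SVM}}(\theta)=\arg\min_{w}\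 \|w\|_2^2\quad\text{s.t.}\quad \tau_\theta(x_n)\,w^Tx_n\ge 1\quad\forall x_n\in\mathcal{D}.$$
   Context: The parameter $\theta$ is fixed throughout the inner gradient descent, and gradients are taken with respect to $w$ only. Linear separability: there exists $w_*\in\mathbb{R}^d$ with $\tau_\theta(x_n)w_*^Tx_n>0$ for all $x_n\in\mathcal{D}$. Dual solution: $\alpha_{\text{SVM}}(\theta)\in\mathbb{R}^N$ is the solution of the dual hard-margin SVM problem of maximizing $\sum_{n=1}^N\alpha_n-\frac12\sum_{i,j=1}^N\alpha_i\alpha_j\tau_\theta(x_i)\tau_\theta(x_j)x_i^Tx_j$ subject to $\alpha_n\ge 0$ for all $n$. It satisfies $w_{\text{SVM}}(\theta)=\sum_{n=1}^N(\alpha_{\text{SVM}}(\theta))_n\tau_\theta(x_n)x_n$. Non-degeneracy: let $S=\{x_n\in\mathcal{D}:\tau_\theta(x_n)w_{\text{SVM}}(\theta)^Tx_n=1\}$ be the set of support vectors. The dataset is non-degenerate if the support vectors span the data, i.e. the matrix whose columns are the elements of $S$ has the same rank as the matrix whose columns are all the $x_n$, and moreover $(\alpha_{\text{SVM}}(\theta))_n>0$ for every $x_n\in S$ and $(\alpha_{\text{SVM}}(\theta))_n=0$ for the rest. Residual: $r_m(\theta)$ is defined by the decomposition $$w_m=w_{\text{SVM}}(\theta)\log m+\tilde w(\theta)+r_m(\theta),\qquad m\ge 1,$$ where $\tilde w(\theta)$, independent of $m$, is a solution of $$\eta\exp(-\tau_\theta(x_n)\,\tilde w(\theta)^Tx_n)=(\alpha_{\text{SVM}}(\theta))_n\quad\text{for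 all }x_n\in S.$$ Solutions may differ by a component orthogonal to the span of the data. The one meant is the one occurring in the asymptotic expansion of the gradient descent iterates due to Soudry et al. (2018), which states that for almost any non-degenerate linearly separable dataset, any $w_0$ and any $\eta<1/\mathcal{L}_\theta(w_0)$, the iterates have the form $w_m=w_{\text{SVM}}(\theta)\log m+\tilde w(\theta)+r_m(\theta)$ with $\tilde w(\theta)$ a solution of $\eta\exp(-\tau_\theta(x_n)\,\tilde w(\theta)^Tx_n)=(\alpha_{\text{SVM}}(\theta))_n$ for all $x_n\in S$, $r_m(\theta)$ bounded and $\lim_{m\to\infty}\|r_m(\theta)\|_2=0$. "Almost every dataset" is meant in the same sense as in that result of Soudry et al. (2018) (up to a measure-zero set of datasets). *)

theory Defs
  imports "HOL-Analysis.Analysis"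
begin

text \<open>
  A dataset of \<open>N = CARD('n)\<close> points in \<open>\<real>\<^sup>d\<close>, \<open>d = CARD('d)\<close>, is an
  element \<open>X\<close> of \<open>(\<real>\<^sup>d)\<^sup>N\<close> with \<open>x\<^sub>n = X $ n\<close>. Being a point of a Euclidean
  space, it makes ``almost every dataset'' meaningful with respect to Lebesgue measure.
\<close>

definition tau :: "(real \<Rightarrow> real) \<Rightarrow> real^'d \<Rightarrow> real^'d \<Rightarrow> real" where
  "tau \<sigma> \<theta> x = \<sigma> (\<theta> \<bullet> x)"

definition loss :: "(real \<Rightarrow> real) \<Rightarrow> real^'d \<Rightarrow> real^'d^'n \<Rightarrow> real^'d \<Rightarrow> real" where
  "loss \<sigma> \<theta> X w = (\<Sum>n\<in>UNIV. exp (- (tau \<sigma> \<theta> (X $ n) * (w \<bullet> X $ n))))"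

definition grad :: "('a::real_inner \<Rightarrow> real) \<Rightarrow> 'a \<Rightarrow> 'a" where
  "grad f w = (THE g. GDERIV f w :> g)"

primrec gd_iterate ::
    "(real \<Rightarrow> real) \<Rightarrow> real^'d \<Rightarrow> real^'d^'n \<Rightarrow> real \<Rightarrow> real^'d \<Rightarrow> nat \<Rightarrow> real^'d" where
  "gd_iterate \<sigma> \<theta> X \<eta> w0 0 = w0"
| "gd_iterate \<sigma> \<theta> X \<eta> w0 (Suc m) =
     gd_iterate \<sigma> \<theta> X \<eta> w0 m - \<eta> *\<^sub>R grad (loss \<sigma> \<theta> X) (gd_iterate \<sigma> \<theta> X \<eta> w0 m)"

definition binary_loss ::
    "(real \<Rightarrow> real) \<Rightarrow> real^'d \<Rightarrow> real^'d^'n \<Rightarrow> real \<Rightarrow> real^'d \<Rightarrow> nat \<Rightarrow> real" where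
  "binary_loss \<sigma> \<theta> X \<eta> w0 M =
     (\<Sum>n\<in>UNIV. exp (- (tau \<sigma> \<theta> (X $ n) * (gd_iterate \<sigma> \<theta> X \<eta> w0 M \<bullet> X $ n))))"

definition linearly_separable :: "(real \<Rightarrow> real) \<Rightarrow> real^'d \<Rightarrow> real^'d^'n \<Rightarrow> bool" where
  "linearly_separable \<sigma> \<theta> X \<longleftrightarrow> (\<exists>w. \<forall>n. tau \<sigma> \<theta> (X $ n) * (w \<bullet> X $ n) > 0)"

text \<open>For linearly separable data the minimizer exists and is unique.\<close>

definition w_SVM :: "(real \<Rightarrow> real) \<Rightarrow> real^'d \<Rightarrow> real^'d^'n \<Rightarrow> real^'d" where
  "w_SVM \<sigma> \<theta> X =
     (ARG_MIN (\<lambda>w. (norm w)\<^sup>2) w. \<forall>n. tau \<sigma> \<theta> (X $ n) * (w \<bullet> X $ n) \<ge> 1)"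

definition dual_objective :: "(real \<Rightarrow> real) \<Rightarrow> real^'d \<Rightarrow> real^'d^'n \<Rightarrow> real^'n \<Rightarrow> real" where
  "dual_objective \<sigma> \<theta> X \<alpha> =
     (\<Sum>n\<in>UNIV. \<alpha> $ n) -
     1/2 * (\<Sum>i\<in>UNIV. \<Sum>j\<in>UNIV.
       \<alpha> $ i * \<alpha> $ j * tau \<sigma> \<theta> (X $ i) * tau \<sigma> \<theta> (X $ j) * (X $ i \<bullet> X $ j))"

text \<open>
  A predicate rather than a function of \<open>X\<close>: the primal solution is always unique, but for
  an arbitrary odd \<open>\<sigma>\<close> the dual solution can fail to be, on a set of datasets of positive
  measure. (Take
  \<open>\<sigma> t = t\<close> for \<open>\<bar>t\<bar> \<le> 1\<close> and \<open>\<sigma> t = 1 / t\<close> otherwise, \<open>d = 1\<close>, \<open>N = 2\<close>: if \<open>\<bar>\<theta> x\<^sub>n\<bar> \<ge> 1\<close>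
  for both points, every \<open>\<alpha> \<ge> 0\<close> with \<open>\<alpha>\<^sub>1 + \<alpha>\<^sub>2 = \<theta>\<^sup>2\<close> is optimal.)
\<close>

definition is_alpha_SVM :: "(real \<Rightarrow> real) \<Rightarrow> real^'d \<Rightarrow> real^'d^'n \<Rightarrow> real^'n \<Rightarrow> bool" where
  "is_alpha_SVM \<sigma> \<theta> X \<alpha> \<longleftrightarrow>
     is_arg_max (dual_objective \<sigma> \<theta> X) (\<lambda>\<beta>. \<forall>n. \<beta> $ n \<ge> 0) \<alpha>"

text \<open>Support vectors are recorded by their indices.\<close>

definition support_vectors :: "(real \<Rightarrow> real) \<Rightarrow> real^'d \<Rightarrow> real^'d^'n \<Rightarrow> 'n set" where
  "support_vectors \<sigma> \<theta> X = {n. tau \<sigma> \<theta> (X $ n) * (w_SVM \<sigma> \<theta> X \<bullet> X $ n) = 1}"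

text \<open>
  The number of support vectors is not a type, so the rank of the matrix whose columns
  are the support vectors is written as the dimension of its column space.
\<close>

definition non_degenerate ::
    "(real \<Rightarrow> real) \<Rightarrow> real^'d \<Rightarrow> real^'d^'n \<Rightarrow> real^'n \<Rightarrow> bool" where
  "non_degenerate \<sigma> \<theta> X \<alpha> \<longleftrightarrow>
     dim (($) X ` support_vectors \<sigma> \<theta> X) = rank (transpose X) \<and>
     (\<forall>n\<in>support_vectors \<sigma> \<theta> X. \<alpha> $ n > 0) \<and>
     (\<forall>n. n \<notin> support_vectors \<sigma> \<theta> X \<longrightarrow> \<alpha> $ n = 0)"

definition is_w_tilde ::
    "(real \<Rightarrow> real) \<Rightarrow> real^'d \<Rightarrow> real^'d^'n \<Rightarrow> real \<Rightarrow> real^'n \<Rightarrow> real^'d \<Rightarrow> bool" where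
  "is_w_tilde \<sigma> \<theta> X \<eta> \<alpha> w' \<longleftrightarrow>
     (\<forall>n\<in>support_vectors \<sigma> \<theta> X. \<eta> * exp (- (tau \<sigma> \<theta> (X $ n) * (w' \<bullet> X $ n))) = \<alpha> $ n)"

text \<open>The residual is meaningful for \<open>m \<ge> 1\<close> only.\<close>

definition residual ::
    "(real \<Rightarrow> real) \<Rightarrow> real^'d \<Rightarrow> real^'d^'n \<Rightarrow> real \<Rightarrow> real^'d \<Rightarrow> real^'d \<Rightarrow> nat \<Rightarrow> real^'d" where
  "residual \<sigma> \<theta> X \<eta> w0 w' m =
     gd_iterate \<sigma> \<theta> X \<eta> w0 m - ln (real m) *\<^sub>R w_SVM \<sigma> \<theta> X - w'"

end

theory Submission
  imports Defs "HOL-Real_Asymp.Real_Asymp"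
begin

text \<open>
  Put \<open>y\<^sub>n = \<tau>(x\<^sub>n) x\<^sub>n\<close>, \<open>v = w\<^sub>S\<^sub>V\<^sub>M\<close> and let \<open>S\<close> be the set of support vectors; everything
  depends on the data through the \<open>y\<^sub>n\<close> only. Dual solutions need not be unique, but one of them
  has the form \<open>\<alpha>\<^sub>n = exp (- u \<bullet> y\<^sub>n)\<close> on \<open>S\<close>, where \<open>u\<close> minimizes the strictly convex, coercive function
  \<open>(\<Sum>n\<in>S. exp (- u \<bullet> y\<^sub>n)) + u \<bullet> v\<close> on the span of the data. With this choice the expansion
  holds for every dataset, with no exceptional null set.

  The step size condition makes the loss \<open>L\<close> decrease by at least a multiple of \<open>L\<^sup>2\<close> in each step, so
  \<open>\<Sum>m. L(w\<^sub>m)\<^sup>2\<close> converges. Compare \<open>w\<^sub>m\<close> with \<open>h\<^sub>m v + w'\<close>, where \<open>h\<^sub>m\<^sub>+\<^sub>1 = h\<^sub>m + exp (- h\<^sub>m)\<close> is the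
  scalar gradient descent, for which \<open>h\<^sub>m - ln m\<close> tends to \<open>0\<close>. Up to a summable error, the squared
  distance decreases by \<open>2 exp (- h\<^sub>m) \<Phi>\<close>, where \<open>\<Phi> \<ge> 0\<close> vanishes only at distance \<open>0\<close>. As
  \<open>\<Sum>m. exp (- h\<^sub>m)\<close> diverges, the distance tends to \<open>0\<close>. The lower bound on the loss comes from the
  support vectors alone, since \<open>\<Sum>n\<in>S. \<alpha>\<^sub>n = \<parallel>v\<parallel>\<^sup>2\<close>.
\<close>

section \<open>Elementary inequalities in one real variable\<close>

lemma exp_le_quadratic:
  fixes x :: real
  assumes "\<bar>x\<bar> \<le> 1"
  shows "exp x \<le> 1 + x + x\<^sup>2"
proof (cases "0 \<le> x")
  case True
  then show ?thesis using exp_bound[of x] assms by simp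
next
  case False
  define t where "t = - x"
  have t: "0 \<le> t" "t \<le> 1" using False assms by (auto simp: t_def)
  have "1 + t \<le> exp t" by simp
  \<comment> \<open>The product on the right equals \<open>1 + t^3\<close>.\<close>
  moreover have "1 \<le> (1 - t + t\<^sup>2) * (1 + t)"
    using t by (simp add: algebra_simps power2_eq_square)
  moreover have "0 < 1 - t + t\<^sup>2"
    using t by (cases "t = 1") (auto intro: add_pos_nonneg)
  ultimately have "1 \<le> (1 - t + t\<^sup>2) * exp t"
    by (meson mult_left_mono order_trans less_imp_le)
  then have "exp (- t) \<le> 1 - t + t\<^sup>2"
    by (simp add: exp_minus field_simps)
  then show ?thesis by (simp add: t_def)
qed

text \<open>Divide by \<open>t\<close> and let it tend to 0. This is the first-order optimality
  condition for variations that are only allowed in one direction.\<close>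

lemma nonpos_if_quadratic_bound:
  fixes p q :: real
  assumes "\<And>t. 0 < t \<Longrightarrow> t < 1 \<Longrightarrow> t * p \<le> t\<^sup>2 * q"
  shows "p \<le> 0"
proof (rule ccontr)
  assume "\<not> p \<le> 0"
  then have p: "p > 0" by simp
  have b: "p \<le> t * q" if "0 < t" "t < 1" for t
    using assms[OF that] that by (simp add: power2_eq_square)
  have "p \<le> q / 2" using b[of "1/2"] by simp
  then have q: "q > 0" "p / (2 * q) < 1" using p by (auto simp: field_simps)
  \<comment> \<open>The choice \<open>t = p / (2 * q)\<close> turns the bound into
    \<open>p \<le> p / 2\<close>.\<close>
  have "p \<le> p / (2 * q) * q" using p q by (intro b) auto
  then show False using p q by simp
qed

section \<open>Hard-margin duality for vectors \<open>y n\<close>\<close>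

text \<open>Raising a single coordinate of the optimum cannot improve the objective, which gives
  primal feasibility of \<open>v\<close>; rescaling all of \<open>a\<close> gives the
  equality.\<close>

lemma dual_optimum:
  fixes y :: "'n::finite \<Rightarrow> 'a::real_inner" and a :: "real^'n"
  defines "v \<equiv> \<Sum>n\<in>UNIV. a $ n *\<^sub>R y n"
  assumes nonneg: "\<And>n. a $ n \<ge> 0"
    and opt: "\<And>b. (\<And>n. b $ n \<ge> 0) \<Longrightarrow>
      (\<Sum>n\<in>UNIV. b $ n) - (norm (\<Sum>n\<in>UNIV. b $ n *\<^sub>R y n))\<^sup>2 / 2
        \<le> (\<Sum>n\<in>UNIV. a $ n) - (norm v)\<^sup>2 / 2"
  shows "v \<bullet> y n \<ge> 1" and "(\<Sum>n\<in>UNIV. a $ n) = (norm v)\<^sup>2"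
proof -
  have "t * (1 - v \<bullet> y n) \<le> t\<^sup>2 * ((norm (y n))\<^sup>2 / 2)" if "0 < t" for t
  proof -
    let ?b = "a + axis n t"
    have "(\<Sum>i\<in>UNIV. ?b $ i *\<^sub>R y i) = v + t *\<^sub>R y n"
      by (simp add: v_def axis_def scaleR_add_left sum.distrib if_distrib[of "\<lambda>c. c *\<^sub>R _"] cong: if_cong)
    moreover have "(\<Sum>i\<in>UNIV. ?b $ i) = (\<Sum>i\<in>UNIV. a $ i) + t"
      by (simp add: axis_def sum.distrib)
    moreover have "?b $ i \<ge> 0" for i using nonneg that by (simp add: axis_def)
    moreover have "(norm (v + t *\<^sub>R y n))\<^sup>2 = (norm v)\<^sup>2 + 2 * t * (v \<bullet> y n) + t\<^sup>2 * (norm (y n))\<^sup>2"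
      unfolding power2_norm_eq_inner
      by (simp add: inner_add_left inner_add_right inner_commute power2_eq_square algebra_simps)
    ultimately show ?thesis using opt[of ?b] by (simp add: algebra_simps)
  qed
  then have "1 - v \<bullet> y n \<le> 0" by (intro nonpos_if_quadratic_bound[of _ "(norm (y n))\<^sup>2 / 2"]) auto
  then show "v \<bullet> y n \<ge> 1" by simp
next
  let ?A = "\<Sum>n\<in>UNIV. a $ n" and ?V = "(norm v)\<^sup>2"
  \<comment> \<open>Optimality along the ray through \<open>a\<close> replaces complementary slackness.\<close>
  have scale: "t * (?A - ?V) \<le> t\<^sup>2 * (?V / 2)" if "t > -1" for t
  proof -
    have "(\<Sum>i\<in>UNIV. ((1 + t) *\<^sub>R a) $ i *\<^sub>R y i) = (1 + t) *\<^sub>R v"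
      by (simp add: v_def scaleR_sum_right)
    moreover have "(\<Sum>i\<in>UNIV. ((1 + t) *\<^sub>R a) $ i) = (1 + t) * ?A"
      by (simp add: sum_distrib_left)
    moreover have "((1 + t) *\<^sub>R a) $ i \<ge> 0" for i using nonneg[of i] that by simp
    moreover have "(norm ((1 + t) *\<^sub>R v))\<^sup>2 = (1 + t)\<^sup>2 * (norm v)\<^sup>2"
      by (simp add: power_mult_distrib)
    ultimately have "(1 + t) * ?A - (1 + t)\<^sup>2 * ?V / 2 \<le> ?A - ?V / 2"
      using opt[of "(1 + t) *\<^sub>R a"] by simp
    then show ?thesis by (simp add: power2_eq_square algebra_simps)
  qed
  have "?A - ?V \<le> 0" by (rule nonpos_if_quadratic_bound[of _ "?V / 2"]) (use scale in auto)
  moreover have "?V - ?A \<le> 0"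
  proof (rule nonpos_if_quadratic_bound)
    fix t :: real assume "0 < t" "t < 1"
    then show "t * (?V - ?A) \<le> t\<^sup>2 * (?V / 2)" using scale[of "- t"] by (simp add: algebra_simps)
  qed
  ultimately show "?A = ?V" by simp
qed

text \<open>Weak duality: weighting the constraints on \<open>u\<close> by the multipliers gives
  \<open>(norm v)^2 \<le> u \<bullet> v\<close>, and expanding \<open>(norm (u - v))^2\<close>
  yields both minimality and uniqueness.\<close>

lemma min_norm_from_dual:
  fixes y :: "'n::finite \<Rightarrow> 'a::real_inner" and a :: "real^'n"
  defines "v \<equiv> \<Sum>n\<in>UNIV. a $ n *\<^sub>R y n"
  assumes nonneg: "\<And>n. a $ n \<ge> 0" and sum: "(\<Sum>n\<in>UNIV. a $ n) = (norm v)\<^sup>2"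
    and u: "\<And>n. u \<bullet> y n \<ge> 1"
  shows "norm v \<le> norm u" and "norm u \<le> norm v \<Longrightarrow> u = v"
proof -
  have "(norm v)\<^sup>2 \<le> (\<Sum>n\<in>UNIV. a $ n * (u \<bullet> y n))"
    unfolding sum[symmetric] using nonneg u by (intro sum_mono) (metis mult.right_neutral mult_left_mono)
  also have "\<dots> = u \<bullet> v" by (simp add: v_def inner_sum_right)
  finally have *: "(norm v)\<^sup>2 \<le> u \<bullet> v" .
  have **: "(norm (u - v))\<^sup>2 = (norm u)\<^sup>2 - 2 * (u \<bullet> v) + (norm v)\<^sup>2"
    by (simp add: power2_norm_eq_inner inner_diff_left inner_diff_right inner_commute)
  have "0 \<le> (norm u)\<^sup>2 - (norm v)\<^sup>2"
    using * ** zero_le_power2[of "norm (u - v)"] by linarith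
  then show "norm v \<le> norm u" by - (rule power2_le_imp_le, auto)
  assume "norm u \<le> norm v"
  then have "(norm u)\<^sup>2 \<le> (norm v)\<^sup>2" by (simp add: power_mono)
  then have "(norm (u - v))\<^sup>2 \<le> 0" using * ** by linarith
  then show "u = v" by simp
qed

section \<open>Scalar gradient descent and its logarithmic growth\<close>

text \<open>Each step raises \<open>exp (h m)\<close> by at least 1 and at most
  \<open>1 + 1 / (m + 1)\<close>, so this quantity grows like \<open>m\<close>.\<close>

lemma scalar_descent_asymptotics:
  fixes h :: "nat \<Rightarrow> real"
  assumes h0: "h 0 = 0" and hS: "\<And>m. h (Suc m) = h m + exp (- h m)"
  shows "ln (real (Suc m)) \<le> h m"
    and "\<not> summable (\<lambda>m. exp (- h m))"
    and "(\<lambda>m. h m - ln (real m)) \<longlonglongrightarrow> 0"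
proof -
  have lower: "real (Suc m) \<le> exp (h m)" for m
  proof (induction m)
    case (Suc m)
    have "exp (h m) * (1 + exp (- h m)) \<le> exp (h m) * exp (exp (- h m))"
      by (intro mult_left_mono) auto
    then show ?case using Suc by (simp add: hS exp_add distrib_left flip: exp_add)
  qed (simp add: h0)
  then show ln_le: "ln (real (Suc m)) \<le> h m" for m
    by (metis exp_gt_zero ln_exp ln_le_cancel_iff of_nat_0_less_iff zero_less_Suc)
  \<comment> \<open>The errors \<open>1 / (m + 1)\<close> sum to a logarithm only, but the cruder
    \<open>2 * sqrt m\<close> telescopes easily and is still of lower order than
    \<open>m\<close>.\<close>
  have upper: "exp (h m) \<le> real (Suc m) + 2 * sqrt (real m)" for m
  proof (induction m)
    case (Suc m)
    have e: "exp (- h m) = inverse (exp (h m))" by (simp add: exp_minus)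
    have le: "inverse (exp (h m)) \<le> inverse (real (Suc m))" using lower by (intro le_imp_inverse_le) auto
    also have "inverse (real (Suc m)) \<le> 1" by (simp add: field_simps)
    finally have "exp (exp (- h m)) \<le> 1 + exp (- h m) + (exp (- h m))\<^sup>2"
      unfolding e by (intro exp_le_quadratic) auto
    then have "exp (h m) * exp (exp (- h m)) \<le> exp (h m) * (1 + exp (- h m) + (exp (- h m))\<^sup>2)"
      by (intro mult_left_mono) auto
    also have "\<dots> = exp (h m) + 1 + inverse (exp (h m))"
      by (simp add: e field_simps power2_eq_square)
    finally have "exp (h (Suc m)) \<le> exp (h m) + 1 + inverse (real (Suc m))"
      using le unfolding hS exp_add by linarith
    moreover have "inverse (real (Suc m)) \<le> 2 * (sqrt (real (Suc m)) - sqrt (real m))"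
    proof -
      define r s where "r = sqrt (real (Suc m))" and "s = sqrt (real m)"
      have rs: "r * r = s * s + 1" "1 \<le> r" "s \<le> r" by (auto simp: r_def s_def)
      have "1 = (r - s) * (r + s)" using rs by (simp add: algebra_simps)
      also have "\<dots> \<le> (r - s) * (2 * (r * r))"
        using rs mult_left_mono[of 1 r r] by (intro mult_left_mono) auto
      finally have "1 \<le> 2 * (r - s) * (r * r)" by (simp only: mult_ac)
      moreover have "0 < r * r" using rs(2) by simp
      ultimately have "inverse (r * r) \<le> 2 * (r - s)"
        by (simp only: inverse_eq_divide pos_divide_le_eq)
      moreover have "r * r = real (Suc m)" by (simp add: r_def)
      ultimately show ?thesis by (simp add: r_def s_def)
    qed
    ultimately show ?case using Suc by simp
  qed (simp add: h0)
  \<comment> \<open>By the recursion the partial sums are the values of \<open>h\<close> themselves,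
    and these are unbounded.\<close>
  show "\<not> summable (\<lambda>m. exp (- h m))"
  proof
    assume "summable (\<lambda>m. exp (- h m))"
    then have "(\<Sum>k<m. exp (- h k)) \<le> (\<Sum>k. exp (- h k))" for m
      by (intro sum_le_suminf) auto
    moreover have "(\<Sum>k<m. exp (- h k)) = h m" for m
      by (induction m) (auto simp: h0 hS)
    ultimately have bound: "ln (real (Suc m)) \<le> (\<Sum>k. exp (- h k))" for m
      using ln_le order_trans by metis
    have "filterlim (\<lambda>m. ln (real (Suc m))) at_top sequentially" by real_asymp
    then have "\<forall>\<^sub>F m in sequentially. ln (real (Suc m)) > (\<Sum>k. exp (- h k))"
      by (simp add: filterlim_at_top_dense)
    then show False using bound by (auto simp: eventually_sequentially not_le[symmetric])
  qed
  show "(\<lambda>m. h m - ln (real m)) \<longlonglongrightarrow> 0"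
  proof (rule tendsto_sandwich)
    show "\<forall>\<^sub>F m in sequentially. ln (real (Suc m)) - ln (real m) \<le> h m - ln (real m)"
      using ln_le by simp
    show "(\<lambda>m. ln (real (Suc m)) - ln (real m)) \<longlonglongrightarrow> 0" by real_asymp
    show "\<forall>\<^sub>F m in sequentially. h m - ln (real m)
        \<le> ln (real (Suc m) + 2 * sqrt (real m)) - ln (real m)"
    proof (intro always_eventually allI)
      fix m
      show "h m - ln (real m) \<le> ln (real (Suc m) + 2 * sqrt (real m)) - ln (real m)"
        using upper[of m] by (metis diff_right_mono exp_gt_zero ln_exp ln_mono order_less_le_trans)
    qed
    show "(\<lambda>m. ln (real (Suc m) + 2 * sqrt (real m)) - ln (real m)) \<longlonglongrightarrow> 0"
      by real_asymp
  qed
qed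

section \<open>Dual variables of exponential form\<close>

lemma eq_0_if_in_span_orthogonal:
  fixes y :: "'n \<Rightarrow> 'a::euclidean_space"
  assumes "u \<in> span (y ` S)" and "\<And>n. n \<in> S \<Longrightarrow> u \<bullet> y n = 0"
  shows "u = 0"
proof -
  have "orthogonal u u"
    using assms by (intro orthogonal_to_span[OF assms(1)]) (auto simp: orthogonal_def)
  then show ?thesis by (simp add: orthogonal_def)
qed

text \<open>The weighted sum is a norm on the span, since only 0 is orthogonal to all generators;
  compactness of the unit sphere compares it with the Euclidean norm. This yields coercivity in
  \<open>exp_dual_exists\<close>.\<close>

lemma span_norm_bound:
  fixes y :: "'n::finite \<Rightarrow> 'a::euclidean_space" and a :: "'n \<Rightarrow> real"
  assumes a: "\<And>n. n \<in> S \<Longrightarrow> a n > 0"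
  obtains k where "k > 0" "\<And>u. u \<in> span (y ` S) \<Longrightarrow> k * norm u \<le> (\<Sum>n\<in>S. a n * \<bar>u \<bullet> y n\<bar>)"
proof -
  define f where "f u = (\<Sum>n\<in>S. a n * \<bar>u \<bullet> y n\<bar>)" for u
  define K where "K = span (y ` S) \<inter> sphere 0 1"
  have "compact K" unfolding K_def by (intro closed_Int_compact closed_subspace) auto
  have norm_in: "u /\<^sub>R norm u \<in> K" if "u \<in> span (y ` S)" "u \<noteq> 0" for u
    using that by (auto simp: K_def span_scale)
  show thesis
  proof (cases "K = {}")
    \<comment> \<open>Here the span is trivial and any constant works.\<close>
    case True
    then have "u = 0" if "u \<in> span (y ` S)" for u using norm_in that by blast
    then show thesis by (intro that[of 1]) fastforce+
  next
    case False
    have "continuous_on K f" unfolding f_def by (intro continuous_intros)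
    then obtain x where x: "x \<in> K" "\<And>u. u \<in> K \<Longrightarrow> f x \<le> f u"
      using continuous_attains_inf[OF \<open>compact K\<close> False] by blast
    have nonneg: "f u \<ge> 0" for u
      unfolding f_def using a by (intro sum_nonneg mult_nonneg_nonneg) (auto simp: less_imp_le)
    have "f x \<noteq> 0"
    proof
      assume "f x = 0"
      then have "\<forall>n\<in>S. a n * \<bar>x \<bullet> y n\<bar> = 0"
        unfolding f_def using a by (subst (asm) sum_nonneg_eq_0_iff) (auto simp: less_imp_le)
      then have "x \<bullet> y n = 0" if "n \<in> S" for n using a[OF that] that by auto
      then have "x = 0" using eq_0_if_in_span_orthogonal[of x y S] x(1) by (simp add: K_def)
      then show False using x(1) by (simp add: K_def)
    qed
    then have pos: "f x > 0" using nonneg[of x] by simp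
    have "f x * norm u \<le> f u" if "u \<in> span (y ` S)" for u
    proof (cases "u = 0")
      case False
      have "f x \<le> f (u /\<^sub>R norm u)" using x(2) norm_in that False by blast
      also have "\<dots> = f u / norm u"
        by (simp add: f_def abs_mult sum_distrib_left divide_inverse mult_ac)
      finally show ?thesis using False by (simp add: field_simps)
    qed (simp add: nonneg)
    then show thesis using pos by (intro that[of "f x"]) (auto simp: f_def)
  qed
qed

text \<open>The equation for \<open>u\<close> says that the gradient of the potential
  \<open>F\<close> vanishes there. Positivity of \<open>a\<close> makes \<open>F\<close> coercive on
  the span, so a minimizer exists.\<close>

lemma exp_dual_exists:
  fixes y :: "'n::finite \<Rightarrow> 'a::euclidean_space" and a :: "'n \<Rightarrow> real"
  assumes a: "\<And>n. n \<in> S \<Longrightarrow> a n > 0" and v: "v = (\<Sum>n\<in>S. a n *\<^sub>R y n)"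
  obtains u where "v = (\<Sum>n\<in>S. exp (- (u \<bullet> y n)) *\<^sub>R y n)" "u \<in> span (y ` S)"
proof -
  define E where "E = span (y ` S)"
  define F where "F u = (\<Sum>n\<in>S. exp (- (u \<bullet> y n))) + u \<bullet> v" for u
  obtain k where k: "k > 0" "\<And>u. u \<in> E \<Longrightarrow> k * norm u \<le> (\<Sum>n\<in>S. a n * \<bar>u \<bullet> y n\<bar>)"
    using span_norm_bound[of S a y] a unfolding E_def by blast
  define C where "C = (\<Sum>n\<in>S. 2 * (a n)\<^sup>2)"
  \<comment> \<open>For negative \<open>t\<close>, bound \<open>exp (- t)\<close> below by its
    quadratic Taylor term and complete the square \<open>(- t - 2 * b)^2\<close>.\<close>
  have elem: "exp (- t) + b * t \<ge> b * \<bar>t\<bar> - 2 * b\<^sup>2" if "b > 0" for b t :: real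
  proof (cases "t \<ge> 0")
    case False
    then have "exp (- t) \<ge> (- t)\<^sup>2 / 2"
      using exp_lower_Taylor_quadratic[of "- t"] by simp
    moreover have "0 \<le> (- t - 2 * b)\<^sup>2 / 2" by simp
    then have "0 \<le> (- t)\<^sup>2 / 2 + 2 * b * t + 2 * b\<^sup>2" by (simp add: power2_eq_square algebra_simps)
    ultimately show ?thesis using False by (simp add: algebra_simps)
  qed (simp add: add_nonneg_nonneg order_trans[of _ 0] algebra_simps)
  have coercive: "F u \<ge> k * norm u - C" if "u \<in> E" for u
  proof -
    have "(\<Sum>n\<in>S. a n * \<bar>u \<bullet> y n\<bar> - 2 * (a n)\<^sup>2) \<le> (\<Sum>n\<in>S. exp (- (u \<bullet> y n)) + a n * (u \<bullet> y n))"
      using a by (intro sum_mono elem) auto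
    also have "\<dots> = F u" by (simp add: F_def v sum.distrib inner_sum_right)
    finally show ?thesis using k(2)[OF that] by (simp add: C_def sum_subtractf)
  qed
  \<comment> \<open>Beyond radius \<open>R\<close> coercivity puts \<open>F\<close> above
    \<open>F 0\<close>, so a minimum over the ball is a minimum over \<open>E\<close>.\<close>
  define R where "R = (F 0 + C) / k"
  define K where "K = E \<inter> cball 0 R"
  have "F 0 + C \<ge> 0" unfolding F_def C_def by (simp add: sum_nonneg add_nonneg_nonneg)
  then have "0 \<in> K" using k(1) by (auto simp: K_def E_def R_def span_zero)
  have "compact K" unfolding K_def E_def by (intro closed_Int_compact closed_subspace) auto
  moreover have "continuous_on K F" unfolding F_def by (intro continuous_intros)
  ultimately obtain u where u: "u \<in> K" "\<And>x. x \<in> K \<Longrightarrow> F u \<le> F x"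
    using continuous_attains_inf[of K F] \<open>0 \<in> K\<close> by blast
  have min: "F u \<le> F x" if "x \<in> E" for x
  proof (cases "norm x \<le> R")
    case True
    then show ?thesis using u(2)[of x] that by (simp add: K_def)
  next
    case False
    then have "F 0 < F x" using coercive[OF that] k(1) by (simp add: R_def field_simps)
    then show ?thesis using u(2)[OF \<open>0 \<in> K\<close>] by simp
  qed
  have uE: "u \<in> E" using u(1) by (simp add: K_def)
  \<comment> \<open>\<open>e\<close> is the gradient of \<open>F\<close> at \<open>u\<close>. It
    lies in \<open>E\<close>, hence is an admissible direction, and the derivative along it is
    \<open>e \<bullet> e\<close>.\<close>
  define e where "e = v - (\<Sum>n\<in>S. exp (- (u \<bullet> y n)) *\<^sub>R y n)"
  have "e \<in> E" unfolding e_def v E_def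
    by (intro span_diff span_sum span_scale span_base) auto
  have "((\<lambda>t. F (u + t *\<^sub>R e)) has_real_derivative (\<Sum>n\<in>S. exp (- (u \<bullet> y n)) * - (e \<bullet> y n)) + e \<bullet> v) (at 0)"
    unfolding F_def by (auto intro!: derivative_eq_intros sum.cong simp: inner_add_left)
  moreover have "\<forall>t. \<bar>0 - t\<bar> < 1 \<longrightarrow> F (u + 0 *\<^sub>R e) \<le> F (u + t *\<^sub>R e)"
    using min uE \<open>e \<in> E\<close> unfolding E_def by (auto intro!: span_add span_scale)
  ultimately have "(\<Sum>n\<in>S. exp (- (u \<bullet> y n)) * - (e \<bullet> y n)) + e \<bullet> v = 0"
    using DERIV_local_min[of "\<lambda>t. F (u + t *\<^sub>R e)" _ 0 1] by simp
  then have "e \<bullet> e = 0"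
    by (subst (2) e_def) (simp add: inner_diff_right inner_sum_right sum_negf)
  then show thesis using that[of u] uE by (simp add: e_def E_def)
qed

section \<open>Gradient descent on the exponential loss\<close>

text \<open>Telescoping bounds the sum of \<open>c\<close>, and \<open>D\<close> minus the
  accumulated errors is decreasing and bounded below. It is applied to the loss with zero errors and
  to the squared distance from the reference path.\<close>

lemma perturbed_decrease:
  fixes D c e :: "nat \<Rightarrow> real"
  assumes step: "\<And>m. D (Suc m) \<le> D m - c m + e m"
    and D: "\<And>m. D m \<ge> 0" and c: "\<And>m. c m \<ge> 0" and e: "\<And>m. e m \<ge> 0" "summable e"
  shows "summable c" and "convergent D"
proof -
  have e_le: "(\<Sum>k<m. e k) \<le> suminf e" for m by (rule sum_le_suminf) (use e in auto)
  have total: "D m + (\<Sum>k<m. c k) \<le> D 0 + (\<Sum>k<m. e k)" for m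
  proof (induction m)
    case (Suc m)
    then show ?case using step[of m] unfolding sum.lessThan_Suc by linarith
  qed simp
  have "(\<Sum>k<m. c k) \<le> D 0 + suminf e" for m
    using total[of m] D[of m] e_le[of m] by linarith
  then show "summable c" by (rule summableI_nonneg_bounded[OF c])
  have "decseq (\<lambda>m. D m - (\<Sum>k<m. e k))"
  proof (rule decseq_SucI)
    fix m
    show "D (Suc m) - (\<Sum>k<Suc m. e k) \<le> D m - (\<Sum>k<m. e k)"
      using step[of m] c[of m] by simp
  qed
  moreover have "D m - (\<Sum>k<m. e k) \<ge> - suminf e" for m using D[of m] e_le[of m] by simp
  ultimately obtain l where l: "(\<lambda>m. D m - (\<Sum>k<m. e k)) \<longlonglongrightarrow> l"
    using decseq_convergent by blast
  have "(\<lambda>m. (D m - (\<Sum>k<m. e k)) + (\<Sum>k<m. e k)) \<longlonglongrightarrow> l + suminf e"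
    by (intro tendsto_add l summable_LIMSEQ e)
  then show "convergent D" by (auto simp: convergent_def)
qed

text \<open>The labels are absorbed into the vectors \<open>y n\<close>; \<open>eta_small\<close> is
  the step size condition with the division cleared.\<close>

locale exp_loss_descent =
  fixes y :: "'n::finite \<Rightarrow> 'a::euclidean_space" and \<eta> :: real and w :: "nat \<Rightarrow> 'a"
  assumes norm_le_1: "norm (y n) \<le> 1"
    and eta_pos: "0 < \<eta>"
    and eta_small: "\<eta> * (\<Sum>n\<in>UNIV. exp (- (w 0 \<bullet> y n))) < 1"
    and step: "w (Suc m) = w m + \<eta> *\<^sub>R (\<Sum>n\<in>UNIV. exp (- (w m \<bullet> y n)) *\<^sub>R y n)"
begin

definition L :: "nat \<Rightarrow> real" where
  "L m = (\<Sum>n\<in>UNIV. exp (- (w m \<bullet> y n)))"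

text \<open>The negative gradient of the loss at \<open>w m\<close>.\<close>

definition G :: "nat \<Rightarrow> 'a" where
  "G m = (\<Sum>n\<in>UNIV. exp (- (w m \<bullet> y n)) *\<^sub>R y n)"

lemma L_nonneg: "L m \<ge> 0"
  unfolding L_def by (intro sum_nonneg) auto

lemma norm_G_le: "norm (G m) \<le> L m"
  unfolding G_def L_def using norm_le_1 by (intro sum_norm_le) (simp add: mult_left_le)

text \<open>As the \<open>y n\<close> have norm at most 1, each exponent changes by at most
  \<open>\<eta> * L m \<le> 1\<close>, where the quadratic bound on \<open>exp\<close> applies. The
  loss itself acts as the local smoothness constant.\<close>

lemma L_descent:
  assumes "\<eta> * L m \<le> 1"
  shows "L (Suc m) \<le> L m - \<eta> * (1 - \<eta> * L m) * (norm (G m))\<^sup>2"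
proof -
  let ?e = "\<lambda>n. exp (- (w m \<bullet> y n))"
  have elem: "exp (- (w (Suc m) \<bullet> y n)) \<le> ?e n * (1 - \<eta> * (G m \<bullet> y n) + \<eta>\<^sup>2 * (norm (G m))\<^sup>2)" for n
  proof -
    define d where "d = - (\<eta> * (G m \<bullet> y n))"
    have "\<bar>G m \<bullet> y n\<bar> \<le> norm (G m) * norm (y n)" by (rule Cauchy_Schwarz_ineq2)
    also have "\<dots> \<le> norm (G m)" using norm_le_1 by (simp add: mult_left_le)
    finally have Gy: "\<bar>G m \<bullet> y n\<bar> \<le> norm (G m)" .
    then have "\<eta> * \<bar>G m \<bullet> y n\<bar> \<le> \<eta> * L m"
      using norm_G_le[of m] eta_pos by (intro mult_left_mono) auto
    moreover have "\<bar>d\<bar> = \<eta> * \<bar>G m \<bullet> y n\<bar>" using eta_pos by (simp add: d_def abs_mult)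
    ultimately have "\<bar>d\<bar> \<le> 1" using assms by linarith
    then have "exp d \<le> 1 + d + d\<^sup>2" by (rule exp_le_quadratic)
    moreover have "d\<^sup>2 \<le> \<eta>\<^sup>2 * (norm (G m))\<^sup>2"
      using power_mono[OF Gy, of 2] eta_pos
      by (simp add: d_def power_mult_distrib)
    ultimately have "exp d \<le> 1 - \<eta> * (G m \<bullet> y n) + \<eta>\<^sup>2 * (norm (G m))\<^sup>2"
      by (simp add: d_def)
    moreover have "exp (- (w (Suc m) \<bullet> y n)) = ?e n * exp d"
      unfolding exp_add[symmetric] d_def step G_def[symmetric] by (simp add: inner_add_left)
    ultimately show ?thesis by simp
  qed
  have "L (Suc m) \<le> (\<Sum>n\<in>UNIV. ?e n * (1 - \<eta> * (G m \<bullet> y n) + \<eta>\<^sup>2 * (norm (G m))\<^sup>2))"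
    unfolding L_def by (intro sum_mono elem)
  also have "\<dots> = L m - \<eta> * (G m \<bullet> (\<Sum>n\<in>UNIV. ?e n *\<^sub>R y n)) + \<eta>\<^sup>2 * (norm (G m))\<^sup>2 * L m"
    by (simp add: L_def inner_sum_right sum_distrib_left sum_distrib_right sum.distrib sum_subtractf
        algebra_simps)
  also have "\<dots> = L m - \<eta> * (1 - \<eta> * L m) * (norm (G m))\<^sup>2"
    unfolding G_def[symmetric] power2_norm_eq_inner[symmetric]
    by (simp add: power2_eq_square algebra_simps)
  finally show ?thesis .
qed

text \<open>The step size condition reproduces itself: it makes the loss decrease, and a smaller
  loss keeps it valid.\<close>

lemma L_le_initial: "L m \<le> L 0"
proof (induction m)
  case (Suc m)
  have "\<eta> * L m \<le> \<eta> * L 0" using Suc eta_pos by simp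
  also have "\<dots> < 1" using eta_small by (simp add: L_def)
  finally have "\<eta> * L m \<le> 1" by simp
  moreover from this have "0 \<le> \<eta> * (1 - \<eta> * L m) * (norm (G m))\<^sup>2" using eta_pos by simp
  ultimately have "L (Suc m) \<le> L m" using L_descent[of m] by linarith
  with Suc show ?case by simp
qed simp

text \<open>The margin gives \<open>L m \<le> norm v * norm (G m)\<close>, which turns a decrease
  measured by the gradient into one measured by the loss.\<close>

lemma summable_L_squared:
  assumes margin: "\<And>n. v \<bullet> y n \<ge> 1"
  shows "summable (\<lambda>m. (L m)\<^sup>2)"
proof -
  have v: "norm v > 0" using margin by force
  \<comment> \<open>The factor \<open>1 - \<eta> * L 0\<close> is a lower bound for
    \<open>1 - \<eta> * L m\<close> that is uniform in \<open>m\<close>.\<close>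
  define c where "c = \<eta> * (1 - \<eta> * L 0) / (norm v)\<^sup>2"
  have gap: "1 - \<eta> * L 0 > 0" using eta_small by (simp add: L_def)
  then have c: "c > 0" using eta_pos v by (simp add: c_def)
  have decrease: "L (Suc m) \<le> L m - c * (L m)\<^sup>2" for m
  proof -
    have le: "\<eta> * L m \<le> \<eta> * L 0" using L_le_initial eta_pos by simp
    have "L m \<le> (\<Sum>n\<in>UNIV. exp (- (w m \<bullet> y n)) * (v \<bullet> y n))"
      unfolding L_def using margin by (intro sum_mono) simp
    also have "\<dots> = v \<bullet> G m" by (simp add: G_def inner_sum_right)
    also have "\<dots> \<le> norm v * norm (G m)" by (rule norm_cauchy_schwarz)
    finally have "(L m)\<^sup>2 \<le> (norm v * norm (G m))\<^sup>2" using L_nonneg by (rule power_mono)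
    then have "c * (L m)\<^sup>2 \<le> c * (norm v * norm (G m))\<^sup>2" using c by simp
    also have "\<dots> = \<eta> * (1 - \<eta> * L 0) * (norm (G m))\<^sup>2"
      using v by (simp add: c_def power_mult_distrib)
    also have "\<dots> \<le> \<eta> * (1 - \<eta> * L m) * (norm (G m))\<^sup>2"
      using le eta_pos by (intro mult_right_mono mult_left_mono) auto
    finally show ?thesis using L_descent[of m] le gap by simp
  qed
  have "summable (\<lambda>m. c * (L m)\<^sup>2)"
    by (rule perturbed_decrease(1)[of L "\<lambda>m. c * (L m)\<^sup>2" "\<lambda>_. 0"])
      (use decrease L_nonneg c in auto)
  then show ?thesis using c by (simp add: summable_cmult_iff)
qed

text \<open>At \<open>h *\<^sub>R v + p\<close> the support vectors alone contribute the increment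
  \<open>exp (- h) *\<^sub>R v\<close>, so the reference path runs along \<open>v\<close>.
  Assumption \<open>init\<close> fixes the component of \<open>p\<close> orthogonal to the span,
  which the descent never changes.\<close>

lemma convergence:
  fixes v p
  defines "S \<equiv> {n. v \<bullet> y n = 1}"
  defines "a \<equiv> \<lambda>n. \<eta> * exp (- (p \<bullet> y n))"
  assumes margin: "\<And>n. v \<bullet> y n \<ge> 1"
    and spanned: "\<And>n. y n \<in> span (y ` S)"
    and v: "v = (\<Sum>n\<in>S. a n *\<^sub>R y n)"
    and init: "w 0 - p \<in> span (y ` S)"
  shows "(\<lambda>m. w m - ln (real m) *\<^sub>R v - p) \<longlonglongrightarrow> 0"
proof -
  define h where "h = rec_nat 0 (\<lambda>_ x. x + exp (- x :: real))"
  have h: "h 0 = 0" "\<And>m. h (Suc m) = h m + exp (- h m)" by (auto simp: h_def)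
  note h_asymp = scalar_descent_asymptotics[OF h]
  define s where "s m = w m - h m *\<^sub>R v - p" for m
  \<comment> \<open>This is \<open>u\<close> paired with the change, from \<open>p\<close> to
    \<open>p + u\<close>, of the gradient of \<open>\<eta>\<close> times the loss over
    \<open>S\<close>; by convexity it is nonnegative.\<close>
  define \<Phi> where "\<Phi> u = (\<Sum>n\<in>S. a n * ((1 - exp (- (u \<bullet> y n))) * (u \<bullet> y n)))" for u
  \<comment> \<open>\<open>r m\<close> bounds the first-order effect of the points off
    \<open>S\<close>; \<open>e m\<close> adds the second-order terms.\<close>
  define r where "r m = (\<Sum>n\<in>-S. a n * exp (- (h m * (v \<bullet> y n))))" for m
  define e where "e m = 2 * r m + 2 * \<eta>\<^sup>2 * (L m)\<^sup>2 + 2 * (norm v)\<^sup>2 * (exp (- h m))\<^sup>2" for m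
  have a_pos: "a n > 0" for n using eta_pos by (simp add: a_def)
  have elem_nonneg: "(1 - exp (- t)) * t \<ge> 0" for t :: real
    by (cases "t \<ge> 0") (auto intro: mult_nonneg_nonneg mult_nonpos_nonpos)
  have elem_zero: "t = 0" if "(1 - exp (- t)) * t = 0" for t :: real using that by auto
  have Phi_nonneg: "\<Phi> u \<ge> 0" for u
    unfolding \<Phi>_def by (intro sum_nonneg mult_nonneg_nonneg[OF less_imp_le[OF a_pos] elem_nonneg])
  have Phi_zero: "u = 0" if "u \<in> span (y ` S)" "\<Phi> u = 0" for u
  proof -
    have "\<forall>n\<in>S. a n * ((1 - exp (- (u \<bullet> y n))) * (u \<bullet> y n)) = 0"
      using that(2) a_pos elem_nonneg unfolding \<Phi>_def
      by (subst (asm) sum_nonneg_eq_0_iff) (auto simp: less_imp_le)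
    then have "u \<bullet> y n = 0" if "n \<in> S" for n
      using elem_zero[of "u \<bullet> y n"] a_pos[of n] that by fastforce
    then show ?thesis by (rule eq_0_if_in_span_orthogonal[OF that(1)])
  qed
  have weight: "\<eta> * exp (- (w m \<bullet> y n)) = a n * exp (- (h m * (v \<bullet> y n))) * exp (- (s m \<bullet> y n))" for m n
    by (simp add: a_def s_def inner_diff_left inner_add_left flip: exp_add)
  have sG: "s m \<bullet> (\<eta> *\<^sub>R G m - exp (- h m) *\<^sub>R v) \<le> r m - exp (- h m) * \<Phi> (s m)" for m
  proof -
    let ?f = "\<lambda>n. a n * exp (- (h m * (v \<bullet> y n))) * (exp (- (s m \<bullet> y n)) * (s m \<bullet> y n))"
    have "s m \<bullet> (\<eta> *\<^sub>R G m) = (\<Sum>n\<in>UNIV. \<eta> * exp (- (w m \<bullet> y n)) * (s m \<bullet> y n))"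
      by (simp add: G_def inner_sum_right sum_distrib_left mult.assoc)
    also have "\<dots> = (\<Sum>n\<in>UNIV. ?f n)" unfolding weight by (simp only: mult.assoc)
    also have "\<dots> = (\<Sum>n\<in>S. ?f n) + (\<Sum>n\<in>-S. ?f n)"
      by (subst sum.union_disjoint[symmetric]) (auto simp: Compl_partition)
    finally have split: "s m \<bullet> (\<eta> *\<^sub>R G m) = (\<Sum>n\<in>S. ?f n) + (\<Sum>n\<in>-S. ?f n)" .
    have S: "(\<Sum>n\<in>S. ?f n) = exp (- h m) * (s m \<bullet> v) - exp (- h m) * \<Phi> (s m)"
    proof -
      have "(\<Sum>n\<in>S. ?f n) = (\<Sum>n\<in>S. exp (- h m) * (a n * (s m \<bullet> y n))
          - exp (- h m) * (a n * ((1 - exp (- (s m \<bullet> y n))) * (s m \<bullet> y n))))"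
        by (intro sum.cong) (auto simp: S_def algebra_simps)
      also have "\<dots> = exp (- h m) * (\<Sum>n\<in>S. a n * (s m \<bullet> y n)) - exp (- h m) * \<Phi> (s m)"
        by (simp only: \<Phi>_def sum_subtractf sum_distrib_left)
      also have "(\<Sum>n\<in>S. a n * (s m \<bullet> y n)) = s m \<bullet> v"
        by (subst v) (simp add: inner_sum_right)
      finally show ?thesis .
    qed
    \<comment> \<open>Off \<open>S\<close> the sign and size of \<open>s m \<bullet> y n\<close> are
      uncontrolled, but an upper bound suffices.\<close>
    have t_exp: "exp (- t) * t \<le> 1" for t :: real
    proof -
      have "t \<le> exp t" using exp_ge_add_one_self[of t] by linarith
      then show ?thesis by (simp add: exp_minus field_simps)
    qed
    have "(\<Sum>n\<in>-S. ?f n) \<le> r m"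
      unfolding r_def using a_pos t_exp
      by (intro sum_mono) (auto intro!: mult_left_le simp: less_imp_le)
    then show ?thesis unfolding inner_diff_right split S by simp
  qed
  have s_in: "s m \<in> span (y ` S)" for m
  proof -
    have "w m - p \<in> span (y ` S)"
    proof (induction m)
      case (Suc m)
      have "w (Suc m) - p = (w m - p) + \<eta> *\<^sub>R (\<Sum>n\<in>UNIV. exp (- (w m \<bullet> y n)) *\<^sub>R y n)"
        by (simp add: step)
      also have "\<dots> \<in> span (y ` S)" using Suc spanned by (intro span_add span_scale span_sum)
      finally show ?case .
    qed (fact init)
    moreover have "v \<in> span (y ` S)"
      using spanned by (subst v) (intro span_sum span_scale)
    ultimately have "(w m - p) - h m *\<^sub>R v \<in> span (y ` S)" by (rule span_diff[OF _ span_scale])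
    moreover have "s m = (w m - p) - h m *\<^sub>R v" by (simp add: s_def)
    ultimately show ?thesis by (simp only:)
  qed
  have decrease: "(norm (s (Suc m)))\<^sup>2 \<le> (norm (s m))\<^sup>2 - 2 * (exp (- h m) * \<Phi> (s m)) + e m" for m
  proof -
    let ?d = "\<eta> *\<^sub>R G m - exp (- h m) *\<^sub>R v"
    have "s (Suc m) = s m + ?d" by (simp add: s_def h step G_def algebra_simps)
    then have "(norm (s (Suc m)))\<^sup>2 = (norm (s m))\<^sup>2 + 2 * (s m \<bullet> ?d) + (norm ?d)\<^sup>2"
      by (simp only: power2_norm_eq_inner inner_add_left inner_add_right inner_commute[of ?d "s m"])
    moreover have "(norm ?d)\<^sup>2 \<le> 2 * \<eta>\<^sup>2 * (L m)\<^sup>2 + 2 * (norm v)\<^sup>2 * (exp (- h m))\<^sup>2"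
    proof -
      have "norm ?d \<le> norm (\<eta> *\<^sub>R G m) + norm (exp (- h m) *\<^sub>R v)" by (rule norm_triangle_ineq4)
      also have "\<dots> \<le> \<eta> * L m + exp (- h m) * norm v"
        using eta_pos norm_G_le by simp
      finally have "(norm ?d)\<^sup>2 \<le> (\<eta> * L m + exp (- h m) * norm v)\<^sup>2" by (intro power_mono) auto
      also have "\<dots> \<le> 2 * (\<eta> * L m)\<^sup>2 + 2 * (exp (- h m) * norm v)\<^sup>2"
        using zero_le_power2[of "\<eta> * L m - exp (- h m) * norm v"]
        by (simp only: power2_sum power2_diff)
      finally show ?thesis by (simp add: power_mult_distrib mult_ac)
    qed
    ultimately show ?thesis using sG[of m] by (simp add: e_def)
  qed
  have exp_h_le: "exp (- (h m * c)) \<le> real (Suc m) powr (- c)" if "c \<ge> 0" for m c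
    using mult_right_mono[OF h_asymp(1)[of m] that] by (simp add: powr_def mult_ac)
  \<comment> \<open>Comparison with a convergent power series. The exponent \<open>c\<close> is the
    margin of a point off \<open>S\<close>, or 2 for the squared increments of
    \<open>h\<close>.\<close>
  have summable_exp_h: "summable (\<lambda>m. exp (- (h m * c)))" if "c > 1" for c
  proof (rule summable_comparison_test)
    show "\<exists>N. \<forall>m\<ge>N. norm (exp (- (h m * c))) \<le> real (Suc m) powr (- c)"
      using exp_h_le that by simp
    show "summable (\<lambda>m. real (Suc m) powr (- c))"
      using that by (subst summable_Suc_iff) (simp add: summable_real_powr_iff)
  qed
  have "summable e"
  proof -
    have "summable r"
      unfolding r_def using margin
      by (intro summable_sum summable_mult summable_exp_h) (auto simp: S_def less_le)
    moreover have "(exp (- h m))\<^sup>2 = exp (- (h m * 2))" for m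
      by (simp add: power2_eq_square flip: exp_add)
    then have "summable (\<lambda>m. (exp (- h m))\<^sup>2)" using summable_exp_h[of 2] by simp
    ultimately show ?thesis
      unfolding e_def using summable_L_squared[OF margin] by (intro summable_add summable_mult)
  qed
  moreover have "e m \<ge> 0" for m
    unfolding e_def r_def using a_pos by (intro add_nonneg_nonneg mult_nonneg_nonneg sum_nonneg) (auto simp: less_imp_le)
  ultimately have sum_Phi: "summable (\<lambda>m. 2 * (exp (- h m) * \<Phi> (s m)))"
      and "convergent (\<lambda>m. (norm (s m))\<^sup>2)"
    using perturbed_decrease[of "\<lambda>m. (norm (s m))\<^sup>2" "\<lambda>m. 2 * (exp (- h m) * \<Phi> (s m))" e]
      decrease Phi_nonneg by auto
  then obtain D where D: "(\<lambda>m. (norm (s m))\<^sup>2) \<longlonglongrightarrow> D" by (auto simp: convergent_def)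
  \<comment> \<open>Otherwise \<open>s m\<close> would eventually stay in a compact annulus of the
    span, on which \<open>\<Phi>\<close> has a positive minimum; summability of
    \<open>exp (- h m) * \<Phi> (s m)\<close> would then force that of
    \<open>exp (- h m)\<close>.\<close>
  have "D = 0"
  proof (rule ccontr)
    assume "D \<noteq> 0"
    then have "D > 0" using LIMSEQ_le_const[OF D, of 0] by force
    define K where "K = span (y ` S) \<inter> (cball 0 (sqrt (2 * D)) - ball 0 (sqrt (D / 2)))"
    have "compact K"
      unfolding K_def by (intro closed_Int_compact closed_subspace compact_diff) auto
    have "\<forall>\<^sub>F m in sequentially. D / 2 < (norm (s m))\<^sup>2 \<and> (norm (s m))\<^sup>2 < 2 * D"
      using \<open>D > 0\<close> by (intro eventually_conj order_tendstoD[OF D]) auto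
    then have ev: "\<forall>\<^sub>F m in sequentially. s m \<in> K"
    proof eventually_elim
      case (elim m)
      then have "sqrt (D / 2) \<le> norm (s m)" "norm (s m) \<le> sqrt (2 * D)"
        by (auto intro!: real_le_lsqrt real_le_rsqrt)
      then show ?case using s_in by (simp add: K_def)
    qed
    then have "K \<noteq> {}" by (auto simp: eventually_sequentially)
    moreover have "continuous_on K \<Phi>" unfolding \<Phi>_def by (intro continuous_intros)
    ultimately obtain x where x: "x \<in> K" "\<And>u. u \<in> K \<Longrightarrow> \<Phi> x \<le> \<Phi> u"
      using continuous_attains_inf[OF \<open>compact K\<close>] by blast
    have "x \<noteq> 0" using x(1) \<open>D > 0\<close> by (auto simp: K_def)
    then have "\<Phi> x \<noteq> 0" using Phi_zero x(1) by (auto simp: K_def)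
    then have "\<Phi> x > 0" using Phi_nonneg[of x] by simp
    have "summable (\<lambda>m. 2 * \<Phi> x * exp (- h m))"
    proof (rule summable_comparison_test_ev[OF _ sum_Phi])
      show "\<forall>\<^sub>F m in sequentially. norm (2 * \<Phi> x * exp (- h m)) \<le> 2 * (exp (- h m) * \<Phi> (s m))"
        using ev
      proof eventually_elim
        case (elim m)
        then show ?case using x(2) \<open>\<Phi> x > 0\<close> by (simp add: mult.commute)
      qed
    qed
    then have "summable (\<lambda>m. exp (- h m))" using \<open>\<Phi> x > 0\<close> by (simp add: summable_cmult_iff)
    then show False using h_asymp(2) by contradiction
  qed
  then have "(\<lambda>m. sqrt ((norm (s m))\<^sup>2)) \<longlonglongrightarrow> sqrt 0" using D by (intro tendsto_real_sqrt) auto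
  then have "s \<longlonglongrightarrow> 0" by (simp add: tendsto_norm_zero_iff)
  \<comment> \<open>Passing from \<open>h m\<close> to \<open>ln m\<close> costs a multiple of
    \<open>v\<close> that tends to 0.\<close>
  then have "(\<lambda>m. s m + (h m - ln (real m)) *\<^sub>R v) \<longlonglongrightarrow> 0 + 0 *\<^sub>R v"
    by (intro tendsto_add tendsto_scaleR h_asymp(3) tendsto_const)
  then show ?thesis by (simp add: s_def algebra_simps)
qed

end

section \<open>Gradient, dual problem and rank condition of a dataset in terms of signed
  points\<close>

lemma grad_unique:
  assumes "GDERIV f w :> g"
  shows "grad f w = g"
  unfolding grad_def
proof (rule the_equality)
  show "GDERIV f w :> g" by (fact assms)
  fix g' assume "GDERIV f w :> g'"
  then have "(\<lambda>h. h \<bullet> g') = (\<lambda>h. h \<bullet> g)"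
    using assms unfolding gderiv_def by (rule has_derivative_unique)
  then show "g' = g" using inner_eq_zero_iff[of "g' - g"] by (metis inner_diff_right right_minus_eq)
qed

lemma grad_loss:
  "grad (loss \<sigma> \<theta> X) w =
    - (\<Sum>n\<in>UNIV. exp (- (w \<bullet> tau \<sigma> \<theta> (X $ n) *\<^sub>R X $ n)) *\<^sub>R (tau \<sigma> \<theta> (X $ n) *\<^sub>R X $ n))"
  by (rule grad_unique, unfold gderiv_def loss_def)
    (auto intro!: derivative_eq_intros sum.cong simp: inner_sum_right sum_negf fun_eq_iff)

lemma dual_objective_eq:
  "dual_objective \<sigma> \<theta> X \<alpha> = (\<Sum>n\<in>UNIV. \<alpha> $ n)
    - (norm (\<Sum>n\<in>UNIV. \<alpha> $ n *\<^sub>R (tau \<sigma> \<theta> (X $ n) *\<^sub>R X $ n)))\<^sup>2 / 2"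
  by (simp add: dual_objective_def power2_norm_eq_inner inner_sum_left inner_sum_right
      inner_commute sum_distrib_left mult_ac)

lemma dual_SVM_to_primal:
  fixes X :: "real^'d^'n" and \<alpha> :: "real^'n"
  assumes "is_alpha_SVM \<sigma> \<theta> X \<alpha>"
  shows "w_SVM \<sigma> \<theta> X = (\<Sum>n\<in>UNIV. \<alpha> $ n *\<^sub>R (tau \<sigma> \<theta> (X $ n) *\<^sub>R X $ n))" (is "_ = ?v")
    and "tau \<sigma> \<theta> (X $ n) * (w_SVM \<sigma> \<theta> X \<bullet> X $ n) \<ge> 1"
proof -
  define y where "y n = tau \<sigma> \<theta> (X $ n) *\<^sub>R X $ n" for n
  let ?F = "\<lambda>w. \<forall>n. tau \<sigma> \<theta> (X $ n) * (w \<bullet> X $ n) \<ge> 1"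
  have F: "?F w \<longleftrightarrow> (\<forall>n. w \<bullet> y n \<ge> 1)" for w by (simp add: y_def)
  have nonneg: "\<alpha> $ n \<ge> 0" for n
    using assms unfolding is_alpha_SVM_def is_arg_max_linorder by auto
  have opt: "dual_objective \<sigma> \<theta> X b \<le> dual_objective \<sigma> \<theta> X \<alpha>" if "\<And>n. b $ n \<ge> 0" for b
    using assms that unfolding is_alpha_SVM_def is_arg_max_linorder by auto
  have feasible: "?v \<bullet> y n \<ge> 1" and total: "(\<Sum>n\<in>UNIV. \<alpha> $ n) = (norm ?v)\<^sup>2" for n
    using dual_optimum[of \<alpha> y] nonneg opt unfolding dual_objective_eq y_def by blast+
  have least: "norm ?v \<le> norm u" "norm u \<le> norm ?v \<Longrightarrow> u = ?v" if "?F u" for u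
    using min_norm_from_dual[of \<alpha> y u] nonneg total that unfolding F by (auto simp: y_def)
  have "is_arg_min (\<lambda>w. (norm w)\<^sup>2) ?F ?v"
    unfolding is_arg_min_linorder using feasible least(1) F by (auto intro: power_mono)
  \<comment> \<open>\<open>w_SVM\<close> is a choice among minimizers, so the existence of one has
    to come first; uniqueness then identifies the choice.\<close>
  then have "is_arg_min (\<lambda>w. (norm w)\<^sup>2) ?F (w_SVM \<sigma> \<theta> X)"
    unfolding w_SVM_def arg_min_def by (rule someI)
  then have m: "?F (w_SVM \<sigma> \<theta> X)" "(norm (w_SVM \<sigma> \<theta> X))\<^sup>2 \<le> (norm ?v)\<^sup>2"
    unfolding is_arg_min_linorder using feasible F by blast+
  show "tau \<sigma> \<theta> (X $ n) * (w_SVM \<sigma> \<theta> X \<bullet> X $ n) \<ge> 1" using m(1) by blast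
  have "norm (w_SVM \<sigma> \<theta> X) \<le> norm ?v" using m(2) by (rule power2_le_imp_le) simp
  then show "w_SVM \<sigma> \<theta> X = ?v" using least(2) m(1) by blast
qed

text \<open>Feasibility bounds the coordinate sum of a competitor \<open>b\<close> by
  \<open>v \<bullet> u\<close>, which is at most half the sum of the two squared norms. So its
  objective is at most \<open>(norm v)^2 / 2\<close>, the value at \<open>\<alpha>\<close>.\<close>

lemma is_alpha_SVM_if_KKT:
  fixes \<sigma> \<theta> and X :: "real^'d^'n" and \<alpha> :: "real^'n"
  defines "y \<equiv> \<lambda>n. tau \<sigma> \<theta> (X $ n) *\<^sub>R X $ n"
  assumes nonneg: "\<And>n. \<alpha> $ n \<ge> 0" and v: "v = (\<Sum>n\<in>UNIV. \<alpha> $ n *\<^sub>R y n)"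
    and feasible: "\<And>n. v \<bullet> y n \<ge> 1"
    and slack: "\<And>n. v \<bullet> y n \<noteq> 1 \<Longrightarrow> \<alpha> $ n = 0"
  shows "is_alpha_SVM \<sigma> \<theta> X \<alpha>" and "(\<Sum>n\<in>UNIV. \<alpha> $ n) = (norm v)\<^sup>2"
proof -
  have "(\<Sum>n\<in>UNIV. \<alpha> $ n) = (\<Sum>n\<in>UNIV. \<alpha> $ n * (v \<bullet> y n))"
    using slack by (intro sum.cong) force+
  also have "\<dots> = v \<bullet> v" by (subst (2) v) (simp add: inner_sum_right)
  finally show total: "(\<Sum>n\<in>UNIV. \<alpha> $ n) = (norm v)\<^sup>2" by (simp add: power2_norm_eq_inner)
  have "dual_objective \<sigma> \<theta> X b \<le> dual_objective \<sigma> \<theta> X \<alpha>" if b: "\<And>n. b $ n \<ge> 0" for b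
  proof -
    define u where "u = (\<Sum>n\<in>UNIV. b $ n *\<^sub>R y n)"
    have "(\<Sum>n\<in>UNIV. b $ n) \<le> (\<Sum>n\<in>UNIV. b $ n * (v \<bullet> y n))"
      using b feasible by (intro sum_mono) (metis mult.right_neutral mult_left_mono)
    also have "\<dots> = v \<bullet> u" by (simp add: u_def inner_sum_right)
    finally have "(\<Sum>n\<in>UNIV. b $ n) - (norm u)\<^sup>2 / 2 \<le> (norm v)\<^sup>2 / 2"
      using zero_le_power2[of "norm (v - u)"]
      by (simp add: power2_norm_eq_inner inner_diff_left inner_diff_right inner_commute)
    then show ?thesis
      using total by (simp add: dual_objective_eq u_def v y_def)
  qed
  then show "is_alpha_SVM \<sigma> \<theta> X \<alpha>"
    using nonneg by (simp add: is_alpha_SVM_def is_arg_max_linorder)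
qed

text \<open>Inclusion together with equal dimension makes the two spans of points equal.
  Separability forces every label to be nonzero, so multiplying by labels preserves the
  span.\<close>

lemma support_vectors_span:
  fixes X :: "real^'d^'n"
  assumes sep: "linearly_separable \<sigma> \<theta> X"
    and rank: "dim (($) X ` S) = rank (transpose X)"
  shows "tau \<sigma> \<theta> (X $ n) *\<^sub>R X $ n \<in> span ((\<lambda>n. tau \<sigma> \<theta> (X $ n) *\<^sub>R X $ n) ` S)"
proof -
  let ?y = "\<lambda>n. tau \<sigma> \<theta> (X $ n) *\<^sub>R X $ n"
  have tau: "tau \<sigma> \<theta> (X $ n) \<noteq> 0" for n
    using sep unfolding linearly_separable_def by (metis less_irrefl mult_zero_left)
  have "rows X = range (($) X)" by (auto simp: rows_def row_def)
  then have "rank (transpose X) = dim (range (($) X))"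
    unfolding rank_transpose by (simp only: row_rank_def)
  then have "span (($) X ` S) = span (range (($) X))"
    using rank by (intro dim_eq_span) auto
  then have "X $ n \<in> span (($) X ` S)" by (auto intro: span_base)
  also have "\<dots> \<subseteq> span (?y ` S)"
  proof (rule span_minimal)
    show "($) X ` S \<subseteq> span (?y ` S)"
    proof
      fix x assume "x \<in> ($) X ` S"
      then obtain k where k: "k \<in> S" "x = X $ k" by blast
      have "inverse (tau \<sigma> \<theta> x) *\<^sub>R ?y k \<in> span (?y ` S)"
        using k by (intro span_scale span_base) auto
      then show "x \<in> span (?y ` S)" using tau[of k] k by simp
    qed
  qed simp
  finally show ?thesis by (rule span_scale)
qed

section \<open>Expansion and lower bound for a fixed dataset\<close>

theorem proposition3p1:
  fixes \<sigma> :: "real \<Rightarrow> real" and \<theta> :: "real^'d"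
  assumes "\<And>t. \<bar>\<sigma> t\<bar> \<le> 1"
    and "\<And>t. \<sigma> (- t) = - \<sigma> t"
    and "\<theta> \<noteq> 0"
  shows "AE X in (lborel :: (real^'d^'n) measure).
    (\<forall>n. norm (X $ n) \<le> 1) \<longrightarrow>
    linearly_separable \<sigma> \<theta> X \<longrightarrow>
    (\<exists>\<alpha>. is_alpha_SVM \<sigma> \<theta> X \<alpha> \<and> non_degenerate \<sigma> \<theta> X \<alpha>) \<longrightarrow>
    (\<exists>\<alpha>. is_alpha_SVM \<sigma> \<theta> X \<alpha> \<and> non_degenerate \<sigma> \<theta> X \<alpha> \<and>
      (\<forall>w0 \<eta>. 0 < \<eta> \<longrightarrow> \<eta> < 1 / loss \<sigma> \<theta> X w0 \<longrightarrow>
        (\<exists>w'. is_w_tilde \<sigma> \<theta> X \<eta> \<alpha> w' \<and>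
          bounded (residual \<sigma> \<theta> X \<eta> w0 w' ` {1..}) \<and>
          (\<lambda>M. norm (residual \<sigma> \<theta> X \<eta> w0 w' M)) \<longlonglongrightarrow> 0 \<and>
          (\<forall>\<^sub>F M in sequentially.
            binary_loss \<sigma> \<theta> X \<eta> w0 M \<ge>
              inverse (real M * \<eta> * exp (norm (residual \<sigma> \<theta> X \<eta> w0 w' M))) *
              (norm (w_SVM \<sigma> \<theta> X))\<^sup>2))))"
proof (intro AE_I2 impI, elim exE conjE)
  fix X :: "real^'d^'n" and \<beta> :: "real^'n"
  assume X: "\<forall>n. norm (X $ n) \<le> 1" and sep: "linearly_separable \<sigma> \<theta> X"
    and \<beta>: "is_alpha_SVM \<sigma> \<theta> X \<beta>" and nondeg: "non_degenerate \<sigma> \<theta> X \<beta>"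
  define y where "y n = tau \<sigma> \<theta> (X $ n) *\<^sub>R X $ n" for n
  define v where "v = w_SVM \<sigma> \<theta> X"
  define S where "S = support_vectors \<sigma> \<theta> X"
  have y_inner: "tau \<sigma> \<theta> (X $ n) * (w \<bullet> X $ n) = w \<bullet> y n" for w n by (simp add: y_def)
  have S_eq: "S = {n. v \<bullet> y n = 1}" unfolding S_def support_vectors_def v_def y_inner ..
  have feasible: "v \<bullet> y n \<ge> 1" for n
    using dual_SVM_to_primal(2)[OF \<beta>] unfolding y_inner v_def .
  have spanned: "y n \<in> span (y ` S)" for n
    using support_vectors_span[OF sep, of S] nondeg by (simp add: non_degenerate_def S_def y_def[abs_def])
  have "v = (\<Sum>n\<in>UNIV. \<beta> $ n *\<^sub>R y n)"
    using dual_SVM_to_primal(1)[OF \<beta>] by (simp add: v_def y_def)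
  also have "\<dots> = (\<Sum>n\<in>S. \<beta> $ n *\<^sub>R y n)"
    using nondeg by (intro sum.mono_neutral_right) (auto simp: non_degenerate_def S_def)
  finally obtain u where u: "v = (\<Sum>n\<in>S. exp (- (u \<bullet> y n)) *\<^sub>R y n)" "u \<in> span (y ` S)"
    using exp_dual_exists[of S "\<lambda>n. \<beta> $ n" v y] nondeg by (auto simp: non_degenerate_def S_def)
  \<comment> \<open>\<open>\<beta>\<close> itself may admit no \<open>w'\<close>: for linearly
    dependent support vectors the equations for the logarithms of its entries can be inconsistent.
    For \<open>\<alpha>\<close> they are solved through \<open>u\<close>.\<close>
  define \<alpha> :: "real^'n" where "\<alpha> = (\<chi> n. if n \<in> S then exp (- (u \<bullet> y n)) else 0)"
  have v_alpha: "v = (\<Sum>n\<in>UNIV. \<alpha> $ n *\<^sub>R y n)"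
    unfolding \<alpha>_def by (subst u(1)) (intro sum.mono_neutral_cong_left; simp)
  have alpha: "\<alpha> $ n \<ge> 0" "v \<bullet> y n \<noteq> 1 \<Longrightarrow> \<alpha> $ n = 0" for n
    by (auto simp: \<alpha>_def S_eq)
  have KKT: "is_alpha_SVM \<sigma> \<theta> X \<alpha>" "(\<Sum>n\<in>UNIV. \<alpha> $ n) = (norm v)\<^sup>2"
    using is_alpha_SVM_if_KKT[OF alpha(1) v_alpha[unfolded y_def] feasible[unfolded y_def]]
      alpha(2)[unfolded y_def] by blast+
  have "non_degenerate \<sigma> \<theta> X \<alpha>"
    using nondeg by (simp add: non_degenerate_def \<alpha>_def S_def)
  \<comment> \<open>Since \<open>v \<bullet> y\<^sub>n = 1\<close> on \<open>S\<close>, the shift by \<open>ln \<eta> v\<close> below absorbs the step size, so the same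
    \<open>\<alpha>\<close> serves all \<open>\<eta>\<close> and \<open>w\<^sub>0\<close>; \<open>z\<close> is the component of \<open>w\<^sub>0\<close> that gradient descent never changes.\<close>
  moreover have "\<exists>w'. is_w_tilde \<sigma> \<theta> X \<eta> \<alpha> w' \<and>
          bounded (residual \<sigma> \<theta> X \<eta> w0 w' ` {1..}) \<and>
          (\<lambda>M. norm (residual \<sigma> \<theta> X \<eta> w0 w' M)) \<longlonglongrightarrow> 0 \<and>
          (\<forall>\<^sub>F M in sequentially.
            binary_loss \<sigma> \<theta> X \<eta> w0 M \<ge>
              inverse (real M * \<eta> * exp (norm (residual \<sigma> \<theta> X \<eta> w0 w' M))) *
              (norm (w_SVM \<sigma> \<theta> X))\<^sup>2)"
    if eta: "0 < \<eta>" "\<eta> < 1 / loss \<sigma> \<theta> X w0" for w0 \<eta>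
  proof -
    obtain q z where qz: "q \<in> span (y ` S)" "\<And>x. x \<in> span (y ` S) \<Longrightarrow> orthogonal z x" "w0 = q + z"
      using orthogonal_subspace_decomp_exists[of "y ` S" w0] by blast
    have z: "z \<bullet> y n = 0" for n using qz(2)[OF spanned] by (simp add: orthogonal_def)
    define p where "p = u + ln \<eta> *\<^sub>R v + z"
    define w where "w = gd_iterate \<sigma> \<theta> X \<eta> w0"
    define r where "r = residual \<sigma> \<theta> X \<eta> w0 p"
    have w_eq: "w M = ln (real M) *\<^sub>R v + p + r M" for M
      by (simp add: r_def residual_def w_def v_def)
    have p: "\<eta> * exp (- (p \<bullet> y n)) = \<alpha> $ n" if "n \<in> S" for n
    proof -
      have "- (p \<bullet> y n) = - (u \<bullet> y n) - ln \<eta>"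
        using that by (simp add: p_def inner_add_left z S_eq)
      then show ?thesis using that eta(1) by (simp add: \<alpha>_def exp_diff)
    qed
    have tilde: "is_w_tilde \<sigma> \<theta> X \<eta> \<alpha> p"
      unfolding is_w_tilde_def y_inner S_def[symmetric] using p by blast
    have loss_eq: "loss \<sigma> \<theta> X w = (\<Sum>n\<in>UNIV. exp (- (w \<bullet> y n)))" for w
      unfolding loss_def y_inner ..
    have "loss \<sigma> \<theta> X w0 > 0" unfolding loss_eq by (intro sum_pos) auto
    interpret exp_loss_descent y \<eta> w
    proof
      show "norm (y n) \<le> 1" for n
        using mult_mono[of "\<bar>\<sigma> (\<theta> \<bullet> X $ n)\<bar>" 1 "norm (X $ n)" 1] X assms(1) by (simp add: y_def tau_def)
      show "\<eta> * (\<Sum>n\<in>UNIV. exp (- (w 0 \<bullet> y n))) < 1"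
        using eta \<open>loss \<sigma> \<theta> X w0 > 0\<close> by (simp add: w_def pos_less_divide_eq flip: loss_eq)
      show "w (Suc m) = w m + \<eta> *\<^sub>R (\<Sum>n\<in>UNIV. exp (- (w m \<bullet> y n)) *\<^sub>R y n)" for m
        by (simp only: w_def gd_iterate.simps grad_loss y_def scaleR_minus_right diff_minus_eq_add)
    qed (fact eta(1))
    have "r \<longlonglongrightarrow> 0"
    proof -
      have "w 0 - p = q - u - ln \<eta> *\<^sub>R v" by (simp add: w_def p_def qz(3))
      also have "\<dots> \<in> span (y ` S)"
        using spanned u(2) qz(1) by (subst v_alpha) (intro span_diff span_scale span_sum)
      finally have init: "w 0 - p \<in> span (y ` S)" .
      have "v = (\<Sum>n\<in>S. (\<eta> * exp (- (p \<bullet> y n))) *\<^sub>R y n)"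
        by (subst u(1), rule sum.cong) (simp_all add: p, simp add: \<alpha>_def)
      then have "(\<lambda>m. w m - ln (real m) *\<^sub>R v - p) \<longlonglongrightarrow> 0"
        using convergence[of v p] feasible spanned init unfolding S_eq by blast
      then show ?thesis by (simp add: w_eq)
    qed
    moreover have "bounded (r ` {1..})"
      using convergent_imp_bounded[OF \<open>r \<longlonglongrightarrow> 0\<close>] by (rule bounded_subset) auto
    moreover have "binary_loss \<sigma> \<theta> X \<eta> w0 M
        \<ge> inverse (real M * \<eta> * exp (norm (r M))) * (norm v)\<^sup>2" if M: "M \<ge> 1" for M
    proof -
      \<comment> \<open>As \<open>v\<close> has margin 1 on \<open>S\<close>, the right-hand side is
        \<open>\<alpha> $ n / (M * \<eta>)\<close> times \<open>exp (- (r M \<bullet> y n))\<close>,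
        and the last factor is at least \<open>exp (- norm (r M))\<close>.\<close>
      have summand: "inverse (real M * \<eta> * exp (norm (r M))) * \<alpha> $ n \<le> exp (- (w M \<bullet> y n))" if "n \<in> S" for n
      proof -
        have "r M \<bullet> y n \<le> norm (r M) * norm (y n)" by (rule norm_cauchy_schwarz)
        also have "\<dots> \<le> norm (r M)" using norm_le_1 by (simp add: mult_left_le)
        finally have "exp (- norm (r M)) \<le> exp (- (r M \<bullet> y n))" by simp
        then have "exp (- (p \<bullet> y n)) * inverse (real M) * exp (- norm (r M))
            \<le> exp (- (p \<bullet> y n)) * inverse (real M) * exp (- (r M \<bullet> y n))"
          by (intro mult_left_mono) auto
        also have "inverse (real M) = exp (- ln (real M))" using M by (simp add: exp_minus)
        also have "exp (- (p \<bullet> y n)) * exp (- ln (real M)) * exp (- (r M \<bullet> y n)) = exp (- (w M \<bullet> y n))"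
          using that by (simp add: w_eq inner_add_left S_eq flip: exp_add)
        finally show ?thesis
          using M eta(1) unfolding p[OF that, symmetric] by (simp add: exp_minus field_simps)
      qed
      \<comment> \<open>The squared norm enters as the sum of the multipliers, which vanish off
        \<open>S\<close>.\<close>
      have "inverse (real M * \<eta> * exp (norm (r M))) * (norm v)\<^sup>2
          = (\<Sum>n\<in>S. inverse (real M * \<eta> * exp (norm (r M))) * \<alpha> $ n)"
        unfolding KKT(2)[symmetric] sum_distrib_left
        by (intro sum.mono_neutral_right) (auto simp: \<alpha>_def)
      also have "\<dots> \<le> (\<Sum>n\<in>S. exp (- (w M \<bullet> y n)))" by (intro sum_mono summand)
      also have "\<dots> \<le> (\<Sum>n\<in>UNIV. exp (- (w M \<bullet> y n)))" by (intro sum_mono2) auto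
      also have "\<dots> = binary_loss \<sigma> \<theta> X \<eta> w0 M"
        unfolding binary_loss_def y_inner w_def ..
      finally show ?thesis .
    qed
    ultimately show ?thesis
      using tilde unfolding r_def v_def
      by (intro exI[of _ p]) (auto simp: tendsto_norm_zero_iff eventually_sequentially)
  qed
  ultimately show "\<exists>\<alpha>. is_alpha_SVM \<sigma> \<theta> X \<alpha> \<and> non_degenerate \<sigma> \<theta> X \<alpha> \<and>
      (\<forall>w0 \<eta>. 0 < \<eta> \<longrightarrow> \<eta> < 1 / loss \<sigma> \<theta> X w0 \<longrightarrow>
        (\<exists>w'. is_w_tilde \<sigma> \<theta> X \<eta> \<alpha> w' \<and>
          bounded (residual \<sigma> \<theta> X \<eta> w0 w' ` {1..}) \<and>
          (\<lambda>M. norm (residual \<sigma> \<theta> X \<eta> w0 w' M)) \<longlonglongrightarrow> 0 \<and>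
          (\<forall>\<^sub>F M in sequentially.
            binary_loss \<sigma> \<theta> X \<eta> w0 M \<ge>
              inverse (real M * \<eta> * exp (norm (residual \<sigma> \<theta> X \<eta> w0 w' M))) *
              (norm (w_SVM \<sigma> \<theta> X))\<^sup>2)))"
    using KKT(1) by blast
qed

end
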